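(* Let $k$ be a field, let $d\ge 1$ be an integer and let $G=([n],E)$ be a graph. If $L_G^{k}(d)$ is prime, then $G$ does not contain $K_{a,b}$ for any $a,b\ge 1$ with $a+b>d$.
   Context: Graphs are finite simple graphs; $[n]=\{1,\dots,n\}$. $K_{a,b}$ is the complete bipartite graph with parts of sizes $a,b\ge 1$. "$G$ contains $G'$" means that $G$ has a (not necessarily induced) subgraph isomorphic to $G'$. For a graph $G=(V,E)$, a field $k$ and an integer $d\ge 1$, let $S=k[y_{i,\ell} : i\in V,\ \ell\in[d]]$, and for every edge $e=\{i,j\}\in E$ put $f_e^{(d)}=\sum_{\ell=1}^d y_{i,\ell}\,y_{j,\ell}$. The Lovász–Saks–Schrijver ideal is $L_G^{k}(d)=(f_e^{(d)} : e\in E)\subseteq S$. *)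

theory Defs
  imports "HOL-Algebra.Ideal" "HOL-Library.Poly_Mapping" "Graph_Theory.Kuratowski"
begin

text \<open>
  A polynomial in variables of type \<open>'x\<close> maps each monomial (a finitely supported exponent
  vector) to its coefficient; multiplication of poly mappings is convolution.
\<close>

type_synonym ('x, 'k) mpoly = "('x \<Rightarrow>\<^sub>0 nat) \<Rightarrow>\<^sub>0 'k"

definition mpoly_var :: "'x \<Rightarrow> ('x, 'k::field) mpoly" where
  "mpoly_var x = Poly_Mapping.single (Poly_Mapping.single x 1) 1"

text \<open>The polynomial ring over \<open>'k\<close> in the variables belonging to \<open>X\<close> only.\<close>

definition mpoly_ring :: "'x set \<Rightarrow> ('x, 'k::field) mpoly ring" where
  "mpoly_ring X = \<lparr>carrier = {p. \<forall>m \<in> Poly_Mapping.keys p. Poly_Mapping.keys m \<subseteq> X},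
     monoid.mult = (*), one = 1, ring.zero = 0, add = (+)\<rparr>"

text \<open>
  Finite simple graphs are rendered by the locale \<^locale>\<open>pair_graph\<close>: an undirected edge
  \<open>{i, j}\<close> is the pair of opposite arcs \<open>(i, j)\<close> and \<open>(j, i)\<close>. Both arcs give the same
  generator (lemma \<open>lss_poly_commute\<close> below).
\<close>

definition lss_ring :: "'v pair_pre_digraph \<Rightarrow> nat \<Rightarrow> ('v \<times> nat, 'k::field) mpoly ring" where
  "lss_ring G d = mpoly_ring (pverts G \<times> {1..d})"

definition lss_poly :: "nat \<Rightarrow> 'v \<Rightarrow> 'v \<Rightarrow> ('v \<times> nat, 'k::field) mpoly" where
  "lss_poly d i j = (\<Sum>l = 1..d. mpoly_var (i, l) * mpoly_var (j, l))"

definition lss_ideal :: "'v pair_pre_digraph \<Rightarrow> nat \<Rightarrow> ('v \<times> nat, 'k::field) mpoly set" where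
  "lss_ideal G d = genideal (lss_ring G d) {lss_poly d i j | i j. (i, j) \<in> parcs G}"

text \<open>
  \<open>G\<close> has a (not necessarily induced) subgraph that is a complete bipartite graph with parts
  of sizes \<open>a\<close> and \<open>b\<close>; the predicate \<^const>\<open>complete_bipartite_digraph\<close> is invariant under
  isomorphism.
\<close>

definition contains_complete_bipartite :: "'v pair_pre_digraph \<Rightarrow> nat \<Rightarrow> nat \<Rightarrow> bool" where
  "contains_complete_bipartite G a b \<longleftrightarrow>
     (\<exists>H. subgraph H (with_proj G) \<and> complete_bipartite_digraph a b H)"

lemma lss_poly_commute: "lss_poly d i j = lss_poly d j i"
  by (simp add: lss_poly_def mult.commute)

lemma cring_mpoly_ring: "cring (mpoly_ring X :: ('x, 'k::field) mpoly ring)"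
proof (rule cringI)
  show "abelian_group (mpoly_ring X :: ('x, 'k) mpoly ring)"
  proof (rule abelian_groupI)
    fix p assume "p \<in> carrier (mpoly_ring X :: ('x, 'k) mpoly ring)"
    then show "\<exists>q\<in>carrier (mpoly_ring X). q \<oplus>\<^bsub>mpoly_ring X\<^esub> p = \<zero>\<^bsub>mpoly_ring X\<^esub>"
      by (intro bexI[of _ "- p"]) (auto simp: mpoly_ring_def)
  qed (use Poly_Mapping.keys_add in \<open>fastforce simp: mpoly_ring_def algebra_simps\<close>)+
  show "comm_monoid (mpoly_ring X :: ('x, 'k) mpoly ring)"
  proof (rule comm_monoidI)
    fix p q :: "('x, 'k) mpoly"
    assume *: "p \<in> carrier (mpoly_ring X)" "q \<in> carrier (mpoly_ring X)"
    have "Poly_Mapping.keys m \<subseteq> X" if "m \<in> Poly_Mapping.keys (p * q)" for m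
    proof -
      from that keys_mult[of p q] obtain s t where "m = s + t"
        "s \<in> Poly_Mapping.keys p" "t \<in> Poly_Mapping.keys q" by blast
      with * Poly_Mapping.keys_add[of s t] show ?thesis
        by (fastforce simp: mpoly_ring_def)
    qed
    then show "p \<otimes>\<^bsub>mpoly_ring X\<^esub> q \<in> carrier (mpoly_ring X)"
      by (simp add: mpoly_ring_def)
  qed (auto simp: mpoly_ring_def mult_ac)
qed (auto simp: mpoly_ring_def algebra_simps)

lemma lss_poly_in_carrier:
  assumes "i \<in> pverts G" "j \<in> pverts G"
  shows "lss_poly d i j \<in> carrier (lss_ring G d :: (_, 'k::field) mpoly ring)"
proof -
  have "Poly_Mapping.keys m \<subseteq> pverts G \<times> {1..d}"
    if "m \<in> Poly_Mapping.keys (lss_poly d i j :: (_, 'k) mpoly)" for m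
  proof -
    from that Poly_Mapping.keys_sum obtain l where l: "l \<in> {1..d}"
      "m \<in> Poly_Mapping.keys (mpoly_var (i, l) * mpoly_var (j, l) :: (_, 'k) mpoly)"
      unfolding lss_poly_def by fast
    then have "m = Poly_Mapping.single (i, l) 1 + Poly_Mapping.single (j, l) 1"
      by (auto simp: mpoly_var_def mult_single)
    then have "Poly_Mapping.keys m \<subseteq> {(i, l), (j, l)}"
      using Poly_Mapping.keys_add[of "Poly_Mapping.single (i, l) (1::nat)" "Poly_Mapping.single (j, l) 1"]
      by auto
    with l(1) assms show ?thesis by auto
  qed
  then show ?thesis by (simp add: lss_ring_def mpoly_ring_def)
qed

end

theory Submission
  imports Defs "Jordan_Normal_Form.Determinant"
begin

text \<open>
  Suppose that \<open>G\<close> contains a complete bipartite graph with parts \<open>u\<close> and \<open>w\<close> of sizes \<open>a, b \<le> d\<close>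
  where \<open>a + b > d\<close>. Collect the variables of the vertices in \<open>u\<close> as the rows of a generic
  \<open>a \<times> d\<close> matrix \<open>U\<close>, and likewise \<open>w\<close> and \<open>W\<close>. Modulo the ideal \<open>U W\<^sup>T = 0\<close>, so on the zero
  locus \<open>rank U + rank W \<le> d < a + b\<close> and one of the two matrices drops rank: a product of a maximal
  minor of \<open>U\<close> and a maximal minor of \<open>W\<close> vanishes there. Such a product even lies in the ideal:
  extend \<open>U\<close> and \<open>W\<close> by unit rows to \<open>d \<times> d\<close> matrices \<open>M\<close> and \<open>N\<close>, whose determinants are the
  leading maximal minors. The matrix \<open>M N\<^sup>T\<close> has an \<open>a \<times> b\<close> block of entries in the ideal, and
  since \<open>a + b > d\<close> each term of its Leibniz expansion meets this block
  (\<open>lss_minor_mult_lss_minor_in_ideal\<close>).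

  Neither minor lies in the ideal (\<open>lss_minor_notin_lss_ideal\<close>): send the vertices of \<open>u\<close> to the
  first \<open>a\<close> unit vectors and all other vertices to zero. Any two distinct vertices then have
  orthogonal vectors, so every generator vanishes no matter which further edges \<open>G\<close> has, whereas
  the minor of \<open>U\<close> takes the value one; for \<open>W\<close> exchange the two parts. Hence the ideal is not prime.
\<close>

section \<open>Evaluation of polynomials\<close>

definition monom_eval :: "('x \<Rightarrow> 'k::field) \<Rightarrow> ('x \<Rightarrow>\<^sub>0 nat) \<Rightarrow> 'k" where
  "monom_eval v m = (\<Prod>x\<in>Poly_Mapping.keys m. v x ^ Poly_Mapping.lookup m x)"

definition mpoly_eval :: "('x \<Rightarrow> 'k::field) \<Rightarrow> ('x, 'k) mpoly \<Rightarrow> 'k" where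
  "mpoly_eval v p = (\<Sum>m\<in>Poly_Mapping.keys p. Poly_Mapping.lookup p m * monom_eval v m)"

lemma monom_eval_superset:
  assumes "finite A" "Poly_Mapping.keys m \<subseteq> A"
  shows "monom_eval v m = (\<Prod>x\<in>A. v x ^ Poly_Mapping.lookup m x)"
  unfolding monom_eval_def
  by (rule prod.mono_neutral_left) (use assms in \<open>auto simp: in_keys_iff\<close>)

lemma mpoly_eval_superset:
  assumes "finite A" "Poly_Mapping.keys p \<subseteq> A"
  shows "mpoly_eval v p = (\<Sum>m\<in>A. Poly_Mapping.lookup p m * monom_eval v m)"
  unfolding mpoly_eval_def
  by (rule sum.mono_neutral_left) (use assms in \<open>auto simp: in_keys_iff\<close>)

lemma monom_eval_add: "monom_eval v (m + n) = monom_eval v m * monom_eval v n"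
proof -
  let ?A = "Poly_Mapping.keys m \<union> Poly_Mapping.keys n"
  have "monom_eval v (m + n) = (\<Prod>x\<in>?A. v x ^ Poly_Mapping.lookup (m + n) x)"
    by (rule monom_eval_superset) (use Poly_Mapping.keys_add[of m n] in auto)
  also have "\<dots> = (\<Prod>x\<in>?A. v x ^ Poly_Mapping.lookup m x) * (\<Prod>x\<in>?A. v x ^ Poly_Mapping.lookup n x)"
    by (simp add: lookup_add power_add prod.distrib)
  finally show ?thesis
    by (simp add: monom_eval_superset[of ?A])
qed

lemma mpoly_eval_add: "mpoly_eval v (p + q) = mpoly_eval v p + mpoly_eval v q"
proof -
  let ?A = "Poly_Mapping.keys p \<union> Poly_Mapping.keys q"
  have "mpoly_eval v (p + q) = (\<Sum>m\<in>?A. Poly_Mapping.lookup (p + q) m * monom_eval v m)"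
    by (rule mpoly_eval_superset) (use Poly_Mapping.keys_add[of p q] in auto)
  then show ?thesis
    by (simp add: mpoly_eval_superset[of ?A] lookup_add algebra_simps sum.distrib)
qed

lemma mpoly_eval_zero: "mpoly_eval v 0 = 0"
  by (simp add: mpoly_eval_def)

lemma mpoly_eval_single: "mpoly_eval v (Poly_Mapping.single m c) = c * monom_eval v m"
  by (simp add: mpoly_eval_def)

lemma mpoly_eval_sum: "mpoly_eval v (sum f A) = (\<Sum>x\<in>A. mpoly_eval v (f x))"
  by (induction A rule: infinite_finite_induct) (simp_all add: mpoly_eval_zero mpoly_eval_add)

lemma sum_of_terms:
  "p = (\<Sum>m\<in>Poly_Mapping.keys p. Poly_Mapping.single m (Poly_Mapping.lookup p m))"
  by (rule poly_mapping_eqI)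
     (auto simp: lookup_sum lookup_single when_def in_keys_iff)

lemma mpoly_eval_mult: "mpoly_eval v (p * q) = mpoly_eval v p * mpoly_eval v q"
proof -
  let ?t = "\<lambda>p m. Poly_Mapping.single m (Poly_Mapping.lookup p m)"
  have "p * q = (\<Sum>m\<in>Poly_Mapping.keys p. \<Sum>n\<in>Poly_Mapping.keys q. ?t p m * ?t q n)"
    by (subst sum_of_terms[of p], subst sum_of_terms[of q]) (simp add: sum_product)
  then have "mpoly_eval v (p * q) = (\<Sum>m\<in>Poly_Mapping.keys p. \<Sum>n\<in>Poly_Mapping.keys q.
      (Poly_Mapping.lookup p m * monom_eval v m) * (Poly_Mapping.lookup q n * monom_eval v n))"
    by (simp add: mpoly_eval_sum mult_single mpoly_eval_single monom_eval_add mult_ac)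
  then show ?thesis
    by (simp add: mpoly_eval_def sum_product)
qed

lemma mpoly_eval_one: "mpoly_eval v 1 = 1"
  by (simp add: mpoly_eval_single monom_eval_def flip: single_one)

lemma mpoly_eval_var: "mpoly_eval v (mpoly_var x) = v x"
  by (simp add: mpoly_var_def mpoly_eval_single monom_eval_def)

lemma comm_ring_hom_mpoly_eval: "comm_ring_hom (mpoly_eval v)"
  by unfold_locales (simp_all add: mpoly_eval_zero mpoly_eval_one mpoly_eval_add mpoly_eval_mult)

section \<open>Determinants and ideals of the polynomial ring\<close>

lemma mpoly_ring_simps [simp]:
  "p \<otimes>\<^bsub>mpoly_ring X\<^esub> q = p * q" "p \<oplus>\<^bsub>mpoly_ring X\<^esub> q = p + q"
  "\<one>\<^bsub>mpoly_ring X\<^esub> = 1" "\<zero>\<^bsub>mpoly_ring X\<^esub> = 0"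
  by (simp_all add: mpoly_ring_def)

lemma ideal_carrier_mpoly_ring: "ideal (carrier (mpoly_ring X)) (mpoly_ring X)"
  using cring_mpoly_ring by (intro ring.oneideal cring.axioms(1))

lemma one_in_mpoly_ring: "1 \<in> carrier (mpoly_ring X)"
  by (simp add: mpoly_ring_def)

lemma uminus_one_in_mpoly_ring: "- 1 \<in> carrier (mpoly_ring X)"
  by (simp add: mpoly_ring_def)

lemma mpoly_var_in_mpoly_ring: "x \<in> X \<Longrightarrow> mpoly_var x \<in> carrier (mpoly_ring X)"
  by (simp add: mpoly_ring_def mpoly_var_def)

context
  fixes X :: "'x set" and J :: "('x, 'k::field) mpoly set"
  assumes J: "ideal J (mpoly_ring X)"
begin

lemma ideal_add: "p \<in> J \<Longrightarrow> q \<in> J \<Longrightarrow> p + q \<in> J"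
  using additive_subgroup.a_closed[OF ideal.axioms(1)[OF J]] by simp

lemma ideal_mult: "p \<in> carrier (mpoly_ring X) \<Longrightarrow> q \<in> J \<Longrightarrow> p * q \<in> J"
  using ideal.I_l_closed[OF J] by simp

lemma ideal_sum:
  assumes "\<And>x. x \<in> A \<Longrightarrow> f x \<in> J"
  shows "sum f A \<in> J"
  using assms
proof (induction A rule: infinite_finite_induct)
  case empty
  show ?case using additive_subgroup.zero_closed[OF ideal.axioms(1)[OF J]] by simp
next
  case (infinite A)
  then show ?case using additive_subgroup.zero_closed[OF ideal.axioms(1)[OF J]] by simp
qed (simp add: ideal_add)

lemma det_in_ideal:
  assumes A: "A \<in> carrier_mat n n"
    and terms: "\<And>p. p permutes {0..<n} \<Longrightarrow> (\<Prod>i = 0..<n. A $$ (i, p i)) \<in> J"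
  shows "det A \<in> J"
  unfolding det_def'[OF A]
proof (rule ideal_sum)
  fix p assume "p \<in> {p. p permutes {0..<n}}"
  then have "(\<Prod>i = 0..<n. A $$ (i, p i)) \<in> J" by (simp add: terms)
  then show "signof p * (\<Prod>i = 0..<n. A $$ (i, p i)) \<in> J"
    by (intro ideal_mult) (auto simp: sign_def one_in_mpoly_ring uminus_one_in_mpoly_ring)
qed

end

lemma mpoly_ring_prod:
  assumes "\<And>x. x \<in> A \<Longrightarrow> f x \<in> carrier (mpoly_ring X)"
  shows "prod f A \<in> carrier (mpoly_ring X)"
  using assms
  by (induction A rule: infinite_finite_induct)
     (auto simp: one_in_mpoly_ring intro: ideal_mult[OF ideal_carrier_mpoly_ring])

lemma mpoly_ring_sum:
  assumes "\<And>x. x \<in> A \<Longrightarrow> f x \<in> carrier (mpoly_ring X)"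
  shows "sum f A \<in> carrier (mpoly_ring X)"
  using assms by (rule ideal_sum[OF ideal_carrier_mpoly_ring])

lemma det_in_mpoly_ring:
  assumes A: "A \<in> carrier_mat n n"
    and entries: "\<And>i j. i < n \<Longrightarrow> j < n \<Longrightarrow> A $$ (i, j) \<in> carrier (mpoly_ring X)"
  shows "det A \<in> carrier (mpoly_ring X)"
proof (rule det_in_ideal[OF ideal_carrier_mpoly_ring A], rule mpoly_ring_prod)
  fix p i assume p: "p permutes {0..<n}" and i: "i \<in> {0..<n}"
  then have "p i \<in> {0..<n}" by (simp add: permutes_in_image)
  with i show "A $$ (i, p i) \<in> carrier (mpoly_ring X)" by (simp add: entries)
qed

text \<open>
  The easy direction of the Frobenius--Koenig theorem, modulo an ideal: a permutation cannot map
  \<open>a\<close> rows into the \<open>n - b < a\<close> columns outside the block.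
\<close>

lemma det_in_ideal_of_block:
  assumes J: "ideal J (mpoly_ring X)"
    and A: "A \<in> carrier_mat n n"
    and entries: "\<And>i j. i < n \<Longrightarrow> j < n \<Longrightarrow> A $$ (i, j) \<in> carrier (mpoly_ring X)"
    and block: "\<And>i j. i < a \<Longrightarrow> j < b \<Longrightarrow> A $$ (i, j) \<in> J"
    and le: "a \<le> n" "b \<le> n" and gt: "a + b > n"
  shows "det A \<in> J"
proof (rule det_in_ideal[OF J A])
  fix p assume p: "p permutes {0..<n}"
  have "\<exists>i<a. p i < b"
  proof (rule ccontr)
    assume "\<not> (\<exists>i<a. p i < b)"
    then have sub: "p ` {0..<a} \<subseteq> {b..<n}"
      using permutes_in_image[OF p] le by fastforce
    have "inj_on p {0..<a}"
      using permutes_inj[OF p] by (rule inj_on_subset) simp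
    then have "a \<le> n - b"
      using card_inj_on_le[OF _ sub] by simp
    with le gt show False by simp
  qed
  then obtain i where i: "i < a" "p i < b" by blast
  have "(\<Prod>k = 0..<n. A $$ (k, p k)) = (\<Prod>k\<in>{0..<n} - {i}. A $$ (k, p k)) * A $$ (i, p i)"
    using i le by (subst prod.remove[of _ i]) (simp_all add: mult.commute)
  moreover have "(\<Prod>k\<in>{0..<n} - {i}. A $$ (k, p k)) \<in> carrier (mpoly_ring X)"
  proof (rule mpoly_ring_prod)
    fix k assume "k \<in> {0..<n} - {i}"
    moreover from this have "p k \<in> {0..<n}" using permutes_in_image[OF p, of k] by simp
    ultimately show "A $$ (k, p k) \<in> carrier (mpoly_ring X)" by (simp add: entries)
  qed
  ultimately show "(\<Prod>k = 0..<n. A $$ (k, p k)) \<in> J"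
    by (simp add: ideal_mult[OF J] block[OF i])
qed

section \<open>Maximal minors of the generic matrix\<close>

text \<open>
  For \<open>a \<le> d\<close>, padding with unit rows makes the determinant equal to the minor on the first \<open>a\<close>
  columns, while keeping the matrix square so that determinants can be multiplied. Rows and columns
  are counted from \<open>0\<close>, coordinates of the variables from \<open>1\<close>.
\<close>

definition lss_mat :: "nat \<Rightarrow> (nat \<Rightarrow> 'v) \<Rightarrow> nat \<Rightarrow> ('v \<times> nat, 'k::field) mpoly mat" where
  "lss_mat d u a = mat d d (\<lambda>(i, j). if i < a then mpoly_var (u i, Suc j) else 1\<^sub>m d $$ (i, j))"

lemma lss_mat_carrier: "lss_mat d u a \<in> carrier_mat d d"
  by (simp add: lss_mat_def)

lemma dim_lss_mat [simp]: "dim_row (lss_mat d u a) = d" "dim_col (lss_mat d u a) = d"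
  by (simp_all add: lss_mat_def)

lemma lss_mat_entry_in_lss_ring:
  assumes "u ` {..<a} \<subseteq> pverts G" "i < d" "j < d"
  shows "lss_mat d u a $$ (i, j) \<in> carrier (lss_ring G d)"
  using assms ideal_carrier_mpoly_ring[THEN ideal.axioms(1), THEN additive_subgroup.zero_closed]
  by (auto simp: lss_mat_def lss_ring_def one_in_mpoly_ring intro!: mpoly_var_in_mpoly_ring)

lemma det_lss_mat_in_lss_ring:
  assumes "u ` {..<a} \<subseteq> pverts G"
  shows "det (lss_mat d u a) \<in> carrier (lss_ring G d)"
  unfolding lss_ring_def
  by (rule det_in_mpoly_ring[OF lss_mat_carrier])
     (rule lss_mat_entry_in_lss_ring[OF assms, unfolded lss_ring_def])

lemma lss_mat_mult_transpose_block:
  assumes "i < a" "j < b" "a \<le> d" "b \<le> d"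
  shows "(lss_mat d u a * transpose_mat (lss_mat d w b)) $$ (i, j) = lss_poly d (u i) (w j)"
proof -
  have "(\<Sum>l = 0..<d. mpoly_var (u i, Suc l) * mpoly_var (w j, Suc l)) = lss_poly d (u i) (w j)"
    unfolding lss_poly_def
    by (rule sum.reindex_bij_witness[of _ "\<lambda>l. l - 1" Suc]) auto
  then show ?thesis
    using assms by (simp add: lss_mat_def scalar_prod_def)
qed

text \<open>
  The product of the minors is the determinant of the product of one padded matrix with the
  transpose of the other, where the inner products of rows belonging to \<open>u\<close> and \<open>w\<close> are the
  generators: modulo the ideal, this matrix has an \<open>a \<times> b\<close> zero block.
\<close>

lemma lss_minor_mult_lss_minor_in_ideal:
  fixes J :: "('v \<times> nat, 'k::field) mpoly set"
  assumes J: "ideal J (lss_ring G d)"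
    and u: "u ` {..<a} \<subseteq> pverts G" and w: "w ` {..<b} \<subseteq> pverts G"
    and edges: "\<And>i j. i < a \<Longrightarrow> j < b \<Longrightarrow> lss_poly d (u i) (w j) \<in> J"
    and le: "a \<le> d" "b \<le> d" and gt: "a + b > d"
  shows "det (lss_mat d u a) * det (lss_mat d w b) \<in> J"
proof -
  let ?M = "lss_mat d u a :: ('v \<times> nat, 'k) mpoly mat"
    and ?N = "lss_mat d w b :: ('v \<times> nat, 'k) mpoly mat"
  have "det (?M * transpose_mat ?N) \<in> J"
  proof (rule det_in_ideal_of_block[OF J[unfolded lss_ring_def] _ _ _ le gt])
    fix i j assume "i < d" "j < d"
    then have "(?M * transpose_mat ?N) $$ (i, j) = (\<Sum>l = 0..<d. ?M $$ (i, l) * ?N $$ (j, l))"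
      by (simp add: scalar_prod_def)
    also have "\<dots> \<in> carrier (mpoly_ring (pverts G \<times> {1..d}))"
      using \<open>i < d\<close> \<open>j < d\<close> lss_mat_entry_in_lss_ring[OF u] lss_mat_entry_in_lss_ring[OF w]
      by (auto simp: lss_ring_def intro!: mpoly_ring_sum ideal_mult[OF ideal_carrier_mpoly_ring])
    finally show "(?M * transpose_mat ?N) $$ (i, j) \<in> carrier (mpoly_ring (pverts G \<times> {1..d}))" .
  next
    show "?M * transpose_mat ?N \<in> carrier_mat d d"
      using lss_mat_carrier by (intro mult_carrier_mat) auto
  qed (simp add: lss_mat_mult_transpose_block edges le)
  moreover have "det (?M * transpose_mat ?N) = det ?M * det ?N"
    using det_mult[OF lss_mat_carrier] det_transpose[OF lss_mat_carrier] lss_mat_carrier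
    by (metis transpose_carrier_mat)
  ultimately show ?thesis by simp
qed

section \<open>A point of the variety where a minor does not vanish\<close>

lemma lss_ideal_vanishing:
  fixes v :: "'v \<times> nat \<Rightarrow> 'k::field"
  assumes wf: "pair_wf_digraph G"
    and vanish: "\<And>i j. (i, j) \<in> parcs G \<Longrightarrow> mpoly_eval v (lss_poly d i j) = 0"
    and p: "p \<in> lss_ideal G d"
  shows "mpoly_eval v p = 0"
proof -
  let ?R = "lss_ring G d :: ('v \<times> nat, 'k) mpoly ring"
  let ?Z = "{p \<in> carrier ?R. mpoly_eval v p = 0}"
  interpret R: cring ?R by (simp add: lss_ring_def cring_mpoly_ring)
  interpret ev: comm_ring_hom "mpoly_eval v" by (rule comm_ring_hom_mpoly_eval)
  have ops: "p \<oplus>\<^bsub>?R\<^esub> q = p + q" "p \<otimes>\<^bsub>?R\<^esub> q = p * q" "\<zero>\<^bsub>?R\<^esub> = 0" for p q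
    by (simp_all add: lss_ring_def)
  have neg: "\<ominus>\<^bsub>?R\<^esub> p = - p" if "p \<in> carrier ?R" for p
    using that by (intro R.minus_equality) (auto simp: lss_ring_def mpoly_ring_def)
  have "ideal ?Z ?R"
  proof (rule idealI)
    show "subgroup ?Z (add_monoid ?R)"
    proof (rule R.add.subgroupI)
      show "?Z \<noteq> {}"
        using R.zero_closed ev.hom_zero by (auto simp: ops)
    next
      fix p assume "p \<in> ?Z"
      then show "\<ominus>\<^bsub>?R\<^esub> p \<in> ?Z"
        using R.a_inv_closed[of p] neg[of p]
        by (simp add: ev.hom_uminus)
    next
      fix p q assume "p \<in> ?Z" "q \<in> ?Z"
      then show "p \<oplus>\<^bsub>?R\<^esub> q \<in> ?Z"
        using R.a_closed[of p q] by (simp add: ops ev.hom_add)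
    qed auto
  next
    fix p q assume "p \<in> ?Z" "q \<in> carrier ?R"
    then show "q \<otimes>\<^bsub>?R\<^esub> p \<in> ?Z" "p \<otimes>\<^bsub>?R\<^esub> q \<in> ?Z"
      using R.m_closed[of p q] R.m_closed[of q p] by (simp_all add: ops ev.hom_mult)
  qed (rule R.ring_axioms)
  moreover have "{lss_poly d i j | i j. (i, j) \<in> parcs G} \<subseteq> ?Z"
    using vanish pair_wf_digraph.in_arcsD1[OF wf] pair_wf_digraph.in_arcsD2[OF wf]
    by (auto intro!: lss_poly_in_carrier)
  ultimately have "lss_ideal G d \<subseteq> ?Z"
    unfolding lss_ideal_def by (rule R.genideal_minimal)
  with p show ?thesis by blast
qed

text \<open>
  The \<open>i\<close>-th selected vertex is sent to the \<open>i\<close>-th unit vector. Every pair of distinct vertices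
  becomes orthogonal, which is why edges inside the selected set do no harm.
\<close>

lemma lss_minor_notin_lss_ideal:
  fixes G :: "'v pair_pre_digraph"
  assumes G: "pair_loopfree_digraph G" and inj: "inj_on u {..<a}"
  shows "det (lss_mat d u a) \<notin> (lss_ideal G d :: ('v \<times> nat, 'k::field) mpoly set)"
proof
  assume in_ideal: "det (lss_mat d u a) \<in> (lss_ideal G d :: ('v \<times> nat, 'k) mpoly set)"
  define v :: "'v \<times> nat \<Rightarrow> 'k" where
    "v = (\<lambda>(x, l). if \<exists>i<a. x = u i \<and> l = Suc i then 1 else 0)"
  interpret ev: comm_ring_hom "mpoly_eval v" by (rule comm_ring_hom_mpoly_eval)
  have "mpoly_eval v (lss_poly d x y) = 0" if "(x, y) \<in> parcs G" for x y
  proof -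
    have "x \<noteq> y" using pair_loopfree_digraph.pair_no_loops[OF G that] by simp
    then have "v (x, l) * v (y, l) = 0" for l by (auto simp: v_def)
    then show ?thesis
      unfolding lss_poly_def mpoly_eval_sum mpoly_eval_mult mpoly_eval_var
      by (intro sum.neutral) blast
  qed
  with G in_ideal have "mpoly_eval v (det (lss_mat d u a)) = 0"
    by (auto intro: lss_ideal_vanishing simp: pair_loopfree_digraph_def)
  moreover have "map_mat (mpoly_eval v) (lss_mat d u a) = 1\<^sub>m d"
    using inj by (intro eq_matI)
      (auto simp: lss_mat_def mpoly_eval_var v_def mpoly_eval_zero mpoly_eval_one inj_on_def)
  then have "mpoly_eval v (det (lss_mat d u a)) = 1"
    by (metis det_one ev.hom_det)
  ultimately show False by simp
qed

section \<open>Complete bipartite subgraphs of a graph with prime ideal\<close>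

lemma contains_complete_bipartiteE:
  assumes "contains_complete_bipartite G a b"
  obtains U V where "U \<subseteq> pverts G" "V \<subseteq> pverts G" "card U = a" "card V = b" "U \<times> V \<subseteq> parcs G"
proof -
  from assms obtain H U V where H: "subgraph H (with_proj G)"
    and UV: "verts H = U \<union> V" "card U = a" "card V = b" "arcs_ends H = U \<times> V \<union> V \<times> U"
    unfolding contains_complete_bipartite_def complete_bipartite_digraph_def by blast
  have "arcs_ends H \<subseteq> parcs G"
    using H by (auto simp: subgraph_def compatible_def arcs_ends_def arc_to_ends_def)
  with H UV that[of U V] show ?thesis by (auto simp: subgraph_def)
qed

lemma obtain_enumeration:
  assumes "1 \<le> c" "c \<le> card U"
  obtains u where "inj_on u {..<c}" "u ` {..<c} \<subseteq> U"
proof -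
  from assms have "finite U" by (metis card.infinite not_one_le_zero le_trans)
  with assms show ?thesis
    using card_le_inj[of "{..<c}" U] that by auto
qed

theorem proposition4p4:
  fixes G :: "nat pair_pre_digraph" and n d :: nat
  assumes "d \<ge> 1"
    and "pair_graph G" and "pverts G = {1..n}"
    and "primeideal (lss_ideal G d :: (nat \<times> nat, 'k::field) mpoly set) (lss_ring G d)"
  shows "\<forall>a b. a \<ge> 1 \<longrightarrow> b \<ge> 1 \<longrightarrow> a + b > d \<longrightarrow> \<not> contains_complete_bipartite G a b"
proof (intro allI impI notI)
  fix a b :: nat
  assume ab: "a \<ge> 1" "b \<ge> 1" "a + b > d" and K: "contains_complete_bipartite G a b"
  let ?L = "lss_ideal G d :: (nat \<times> nat, 'k) mpoly set"
  interpret G: pair_graph G by fact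
  interpret L: primeideal ?L "lss_ring G d" by fact
  \<comment> \<open>Parts with more than \<open>d\<close> vertices are cut down so that they have maximal minors with \<open>d\<close> columns.\<close>
  define a' where "a' = min a d"
  define b' where "b' = min b d"
  have ab': "1 \<le> a'" "1 \<le> b'" "a' \<le> d" "b' \<le> d" "a' \<le> a" "b' \<le> b" "a' + b' > d"
    using ab assms(1) by (auto simp: a'_def b'_def)
  from K obtain U V where UV: "U \<subseteq> pverts G" "V \<subseteq> pverts G" "card U = a" "card V = b"
    "U \<times> V \<subseteq> parcs G" by (rule contains_complete_bipartiteE)
  obtain u where u: "inj_on u {..<a'}" "u ` {..<a'} \<subseteq> U"
    using obtain_enumeration[of a' U] ab' UV by auto
  obtain w where w: "inj_on w {..<b'}" "w ` {..<b'} \<subseteq> V"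
    using obtain_enumeration[of b' V] ab' UV by auto
  have uG: "u ` {..<a'} \<subseteq> pverts G" and wG: "w ` {..<b'} \<subseteq> pverts G"
    using u w UV by auto
  let ?\<mu> = "det (lss_mat d u a') :: (nat \<times> nat, 'k) mpoly"
    and ?\<nu> = "det (lss_mat d w b') :: (nat \<times> nat, 'k) mpoly"
  have "{lss_poly d i j | i j. (i, j) \<in> parcs G} \<subseteq> ?L"
    unfolding lss_ideal_def
    by (rule L.genideal_self) (auto intro!: lss_poly_in_carrier dest: G.in_arcsD1 G.in_arcsD2)
  then have "lss_poly d (u i) (w j) \<in> ?L" if "i < a'" "j < b'" for i j
    using that u w UV by blast
  then have "?\<mu> * ?\<nu> \<in> ?L"
    using ab' by (intro lss_minor_mult_lss_minor_in_ideal[OF L.is_ideal uG wG])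
  then have "?\<mu> \<in> ?L \<or> ?\<nu> \<in> ?L"
    using L.I_prime[OF det_lss_mat_in_lss_ring[OF uG] det_lss_mat_in_lss_ring[OF wG]]
    by (simp add: lss_ring_def)
  then show False
    using lss_minor_notin_lss_ideal[OF G.pair_loopfree_digraph_axioms] u w by blast
qed

end
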